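(* Let $G\subset \mathrm{SL}(d,\mathbb{R})$ be the semigroup generated by a set $\mathcal{A}\subset\mathrm{SL}(d,\mathbb{R})$ (finite or infinite). If $G$ is irreducible and contains a proximal matrix, then the limit set $\Lambda_{\mathcal{A}}$ of $G$ is equal to the closure in $\mathbb{R}\mathbb{P}^{d-1}$ of the set of all attracting fixed points of proximal elements of $G$.
   Context: $\mathbb{R}\mathbb{P}^{d-1}$ is the projective space of lines through the origin in $\mathbb{R}^d$, equipped with the metric induced by angles (which gives the usual topology). The semigroup $G$ generated by $\mathcal{A}$ is the set of all finite non-empty products of elements of $\mathcal{A}$. Matrices act on $\mathbb{R}\mathbb{P}^{d-1}$ by their linear action on lines. Limit set: let $\mathbb{R}G=\{kA : k\in\mathbb{R},\ A\in G\}$ and let $\overline{\mathbb{R}G}$ be its closure in the space of all real $d\times d$ matrices with the usual topology. The limit set $\Lambda_{\mathcal{A}}$ of $\mathcal{A}$ (equivalently, of $G$) is the set of points of $\mathbb{R}\mathbb{P}^{d-1}$ of the form $\mathrm{Im}\,\pi$ (a line in $\mathbb{R}^d$), where $\pi$ ranges over the elements of $\overline{\mathbb{R}G}$ of rank one. Irreducible: $G$ is irreducible if no proper non-zero linear subspace $L\subset\mathbb{R}^d$ is preserved by all elements of $G$. Proximal: a matrix $A$ is proximal if it has a simple leading eigenvalue, i.e. an eigenvalue $\lambda$ of algebraic multiplicity one whose modulus is strictly larger than the modulus of every other eigenvalue (so $\lambda$ is real). The attracting fixed point of a proximal matrix is its fixed point in $\mathbb{R}\mathbb{P}^{d-1}$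 corresponding to its leading eigenvalue, i.e. the eigenline of $\lambda$. *)

theory Defs
  imports "HOL-Analysis.Analysis" "HOL-Computational_Algebra.Polynomial"
begin

section \<open>Projective space with the angle metric\<close>

text \<open>A point of projective space is a line through the origin; \<open>line_of\<close> is the underlying
  set of vectors.\<close>

typedef (overloaded) ('a::euclidean_space) projective_space =
  "{L :: 'a set. subspace L \<and> dim L = 1}"
  morphisms line_of Abs_projective_space
proof -
  obtain b :: 'a where "b \<in> Basis" by (meson nonempty_Basis ex_in_conv)
  then show ?thesis
    by (intro exI[of _ "span {b}"]) (auto simp: nonzero_Basis)
qed

lemma line_of_span:
  fixes L :: "'a::euclidean_space projective_space"
  assumes "u \<in> line_of L" "u \<noteq> 0"
  shows "line_of L = span {u}"
proof -
  have L: "subspace (line_of L)" "dim (line_of L) = 1" using line_of[of L] by auto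
  show ?thesis
    using subspace_dim_equal[of "span {u}" "line_of L"] span_minimal[of "{u}" "line_of L"] L assms
    by simp
qed

lemma ex_unit_in_line: "\<exists>u. u \<in> line_of L \<and> norm u = 1"
proof -
  have L: "subspace (line_of L)" "dim (line_of L) = 1" using line_of[of L] by auto
  then obtain v where v: "v \<in> line_of L" "v \<noteq> 0"
    by (metis dim_eq_0 subsetI singletonI insertCI zero_neq_one)
  then have "v /\<^sub>R norm v \<in> line_of L" "norm (v /\<^sub>R norm v) = 1"
    using L by (auto simp: subspace_scale)
  then show ?thesis by blast
qed

definition unit_direction :: "'a::euclidean_space projective_space \<Rightarrow> 'a" where
  "unit_direction L = (SOME u. u \<in> line_of L \<and> norm u = 1)"

lemma unit_direction: "unit_direction L \<in> line_of L" "norm (unit_direction L) = 1"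
  using someI_ex[OF ex_unit_in_line[of L]] by (auto simp: unit_direction_def)

lemma arccos_triangle:
  fixes u v w :: "'a::real_inner"
  assumes n: "norm u = 1" "norm v = 1" "norm w = 1"
  shows "arccos (u \<bullet> w) \<le> arccos (u \<bullet> v) + arccos (v \<bullet> w)"
proof (cases "arccos (u \<bullet> v) + arccos (v \<bullet> w) \<le> pi")
  case False
  have "\<bar>u \<bullet> w\<bar> \<le> 1" using Cauchy_Schwarz_ineq2[of u w] n by simp
  then show ?thesis using False arccos_ubound[of "u \<bullet> w"] by (auto simp: abs_le_iff)
next
  case True
  have b: "\<bar>u \<bullet> v\<bar> \<le> 1" "\<bar>v \<bullet> w\<bar> \<le> 1" "\<bar>u \<bullet> w\<bar> \<le> 1"
    using Cauchy_Schwarz_ineq2[of u v] Cauchy_Schwarz_ineq2[of v w] Cauchy_Schwarz_ineq2[of u w] n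
    by auto
  define p q where "p = u - (u \<bullet> v) *\<^sub>R v" and "q = w - (v \<bullet> w) *\<^sub>R v"
  have nn: "u \<bullet> u = 1" "v \<bullet> v = 1" "w \<bullet> w = 1" using n by (auto simp: norm_eq_1)
  have pq: "p \<bullet> q = u \<bullet> w - (u \<bullet> v) * (v \<bullet> w)"
    unfolding p_def q_def by (simp add: inner_diff_left inner_diff_right nn inner_commute)
  have np: "norm p = sqrt (1 - (u \<bullet> v)\<^sup>2)"
    unfolding p_def norm_eq_sqrt_inner
    by (simp add: inner_diff_left inner_diff_right nn inner_commute power2_eq_square)
  have nq: "norm q = sqrt (1 - (v \<bullet> w)\<^sup>2)"
    unfolding q_def norm_eq_sqrt_inner
    by (simp add: inner_diff_left inner_diff_right nn inner_commute power2_eq_square)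
  have "cos (arccos (u \<bullet> v) + arccos (v \<bullet> w)) = (u \<bullet> v) * (v \<bullet> w) - norm p * norm q"
    using b by (simp add: cos_add np nq sin_arccos_abs)
  also have "\<dots> \<le> u \<bullet> w" using pq Cauchy_Schwarz_ineq2[of p q] by linarith
  finally have "arccos (u \<bullet> w) \<le> arccos (cos (arccos (u \<bullet> v) + arccos (v \<bullet> w)))"
    using b by (intro arccos_le_arccos) (auto simp: abs_le_iff)
  also have "\<dots> = arccos (u \<bullet> v) + arccos (v \<bullet> w)"
    using True b by (intro arccos_cos add_nonneg_nonneg arccos_lbound) (auto simp: abs_le_iff)
  finally show ?thesis .
qed

instantiation projective_space :: (euclidean_space) metric_space
begin

definition dist_projective_space ::
    "'a projective_space \<Rightarrow> 'a projective_space \<Rightarrow> real" where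
  "dist L M = arccos \<bar>unit_direction L \<bullet> unit_direction M\<bar>"

definition uniformity_projective_space ::
    "('a projective_space \<times> 'a projective_space) filter" where
  "uniformity_projective_space = (INF e\<in>{0<..}. principal {(x, y). dist x y < e})"

definition open_projective_space :: "'a projective_space set \<Rightarrow> bool" where
  "open_projective_space U \<longleftrightarrow>
     (\<forall>x\<in>U. eventually (\<lambda>(x', y). x' = x \<longrightarrow> y \<in> U) uniformity)"

instance
proof
  fix L M N :: "'a projective_space"
  define u v w where uvw: "u = unit_direction L" "v = unit_direction M" "w = unit_direction N"
  have n: "norm u = 1" "norm v = 1" "norm w = 1" by (auto simp: uvw unit_direction)
  have b: "\<bar>x \<bullet> y\<bar> \<le> 1" if "norm x = 1" "norm y = 1" for x y :: 'a
    using Cauchy_Schwarz_ineq2[of x y] that by simp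
  show "dist L M = 0 \<longleftrightarrow> L = M"
  proof
    assume "dist L M = 0"
    then have "cos (arccos \<bar>u \<bullet> v\<bar>) = 1" by (simp add: dist_projective_space_def uvw)
    then have "\<bar>u \<bullet> v\<bar> = norm u * norm v" using b n by (simp add: cos_arccos_abs)
    then have "v = u \<or> v = - u" unfolding norm_cauchy_schwarz_abs_eq using n by simp
    moreover have "subspace (line_of L)" using line_of[of L] by simp
    ultimately have "v \<in> line_of L"
      using unit_direction(1)[of L] uvw by (auto simp: subspace_neg)
    moreover have "v \<in> line_of M" "v \<noteq> 0" using unit_direction(1)[of M] uvw n by auto
    ultimately have "line_of L = line_of M" by (metis line_of_span)
    then show "L = M" by (simp add: line_of_inject)
  next
    assume "L = M"
    then have "u \<bullet> v = 1" using n uvw by (simp add: norm_eq_1)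
    then show "dist L M = 0" by (simp add: dist_projective_space_def flip: uvw)
  qed
  show "dist L M \<le> dist L N + dist M N"
  proof -
    define s t :: real where "s = (if u \<bullet> w < 0 then -1 else 1)" and "t = (if w \<bullet> v < 0 then -1 else 1)"
    have st: "norm (s *\<^sub>R u) = 1" "norm (t *\<^sub>R v) = 1" "(s *\<^sub>R u) \<bullet> w = \<bar>u \<bullet> w\<bar>" "w \<bullet> (t *\<^sub>R v) = \<bar>w \<bullet> v\<bar>"
      "\<bar>(s *\<^sub>R u) \<bullet> (t *\<^sub>R v)\<bar> = \<bar>u \<bullet> v\<bar>"
      using n by (auto simp: s_def t_def)
    have "arccos \<bar>u \<bullet> v\<bar> \<le> arccos ((s *\<^sub>R u) \<bullet> (t *\<^sub>R v))"
      using b[OF st(1,2)] by (subst st(5)[symmetric], intro arccos_le_arccos) (auto simp: abs_le_iff)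
    also have "\<dots> \<le> arccos \<bar>u \<bullet> w\<bar> + arccos \<bar>w \<bullet> v\<bar>"
      using arccos_triangle[OF st(1) n(3) st(2)] st(3,4) by simp
    finally show ?thesis by (simp add: dist_projective_space_def inner_commute flip: uvw)
  qed
qed (rule uniformity_projective_space_def open_projective_space_def)+

end

text \<open>The distance is the angle between the two lines, whichever vectors span them.\<close>

lemma dist_projective_space_angle:
  assumes "u \<in> line_of L" "u \<noteq> 0" "v \<in> line_of M" "v \<noteq> 0"
  shows "dist L M = arccos (\<bar>u \<bullet> v\<bar> / (norm u * norm v))"
proof -
  obtain a b where ab: "u = a *\<^sub>R unit_direction L" "v = b *\<^sub>R unit_direction M"
    using assms unit_direction line_of_span
    by (metis norm_zero rangeE span_singleton zero_neq_one)
  then have "a \<noteq> 0" "b \<noteq> 0" using assms by auto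
  then show ?thesis
    by (simp add: dist_projective_space_def ab abs_mult unit_direction)
qed

section \<open>Semigroups of matrices and their limit sets\<close>

inductive_set generated_semigroup :: "(real^'n^'n) set \<Rightarrow> (real^'n^'n) set"
  for \<A> :: "(real^'n^'n) set" where
  generator: "A \<in> \<A> \<Longrightarrow> A \<in> generated_semigroup \<A>"
| product: "A \<in> generated_semigroup \<A> \<Longrightarrow> B \<in> generated_semigroup \<A> \<Longrightarrow>
    A ** B \<in> generated_semigroup \<A>"

definition limit_set :: "(real^'n^'n) set \<Rightarrow> (real^'n) projective_space set" where
  "limit_set \<A> =
     {p. \<exists>\<pi> \<in> closure {k *\<^sub>R A | k A. A \<in> generated_semigroup \<A>}.
           rank \<pi> = 1 \<and> line_of p = range (\<lambda>x. \<pi> *v x)}"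

definition irreducible_matrices :: "(real^'n^'n) set \<Rightarrow> bool" where
  "irreducible_matrices G \<longleftrightarrow>
     \<not> (\<exists>L :: (real^'n) set. subspace L \<and> L \<noteq> {0} \<and> L \<noteq> UNIV \<and>
          (\<forall>A\<in>G. (\<lambda>x. A *v x) ` L \<subseteq> L))"

section \<open>Proximal matrices\<close>

text \<open>All eigenvalues of a real matrix are taken over the complex numbers.\<close>

definition complexify :: "real^'n^'n \<Rightarrow> complex^'n^'n" where
  "complexify A = map_matrix complex_of_real A"

definition is_eigenvalue :: "'a::field^'n^'n \<Rightarrow> 'a \<Rightarrow> bool" where
  "is_eigenvalue A z \<longleftrightarrow> (\<exists>v. v \<noteq> 0 \<and> A *v v = z *s v)"

definition charpoly :: "'a::comm_ring_1^'n^'n \<Rightarrow> 'a poly" where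
  "charpoly A = det (mat [:0, 1:] - map_matrix (\<lambda>a. [:a:]) A)"

definition alg_multiplicity :: "'a::field^'n^'n \<Rightarrow> 'a \<Rightarrow> nat" where
  "alg_multiplicity A z = order z (charpoly A)"

definition simple_leading_eigenvalue :: "real^'n^'n \<Rightarrow> complex \<Rightarrow> bool" where
  "simple_leading_eigenvalue A z \<longleftrightarrow>
     is_eigenvalue (complexify A) z \<and>
     alg_multiplicity (complexify A) z = 1 \<and>
     (\<forall>w. is_eigenvalue (complexify A) w \<and> w \<noteq> z \<longrightarrow> cmod w < cmod z)"

definition proximal :: "real^'n^'n \<Rightarrow> bool" where
  "proximal A \<longleftrightarrow> (\<exists>z. simple_leading_eigenvalue A z)"

lemma simple_leading_eigenvalue_real:
  assumes "simple_leading_eigenvalue A z"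
  shows "z \<in> \<real>"
proof -
  obtain v where v: "v \<noteq> 0" "complexify A *v v = z *s v"
    using assms by (auto simp: simple_leading_eigenvalue_def is_eigenvalue_def)
  define v' where "v' = (\<chi> i. cnj (v $ i))"
  have "complexify A *v v' = cnj z *s v'"
  proof (rule vec_eq_iff[THEN iffD2], rule allI)
    fix i
    have "cnj ((complexify A *v v) $ i) = cnj ((z *s v) $ i)" using v by simp
    then show "(complexify A *v v') $ i = (cnj z *s v') $ i"
      by (simp add: v'_def matrix_vector_mult_def complexify_def)
  qed
  moreover have "v' \<noteq> 0" using v by (auto simp: v'_def vec_eq_iff)
  ultimately have "is_eigenvalue (complexify A) (cnj z)" by (auto simp: is_eigenvalue_def)
  then have "cnj z = z"
    using assms unfolding simple_leading_eigenvalue_def by (metis complex_mod_cnj less_irrefl)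
  then show ?thesis by (simp add: Reals_cnj_iff)
qed

text \<open>By the previous lemma nothing is lost in taking the leading eigenvalue to be real here. Since
  it has multiplicity one, its eigenspace in \<open>real^'n\<close> is a line, so that a proximal matrix has
  exactly one attracting fixed point.\<close>

definition is_attracting_fixed_point :: "real^'n^'n \<Rightarrow> (real^'n) projective_space \<Rightarrow> bool" where
  "is_attracting_fixed_point A p \<longleftrightarrow>
     (\<exists>l::real. simple_leading_eigenvalue A (complex_of_real l) \<and>
        line_of p = {x. A *v x = l *\<^sub>R x})"

end

theory Submission
  imports Defs "HOL-Computational_Algebra.Fundamental_Theorem_Algebra"
begin

text \<open>
  Both inclusions rest on the correspondence between proximal matrices and matrices of rank one that
  are not nilpotent, that is, multiples of projections to a line.

  If \<open>A\<close> is proximal with leading eigenvalue \<open>l\<close>, then the powers of \<open>A / l\<close> converge to the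
  projection to the eigenline along the complementary invariant hyperplane
  (\<open>proximal_powers_tendsto\<close>). So attracting fixed points lie in the limit set; the limit set is
  closed because rank-one matrices can be normalized and the unit sphere of matrices is compact
  (\<open>closed_limit_set\<close>).

  Conversely, let \<open>p\<close> be the image of a rank-one matrix \<open>\<pi>\<close> in the closure of the cone of
  multiples of semigroup elements. By irreducibility some element \<open>D\<close> of the semigroup moves \<open>p\<close>
  out of the kernel of \<open>\<pi>\<close>; then \<open>\<pi> D\<close> is in this closure
  as well, has image \<open>p\<close>, and is a multiple of a projection. Every matrix close to a
  projection to a line has an eigenvector close to that line, by Brouwer's fixed point theorem
  (\<open>dominant_eigenpair_near_rank_one\<close>), and its eigenvalue is simple and leading
  (\<open>dominant_eigenpair_criterion\<close>). So the semigroup elements whose multiples approach \<open>\<pi> D\<close> are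
  eventually proximal, with attracting fixed points that tend to \<open>p\<close>.

  The link between algebraic multiplicity, defined through the characteristic polynomial, and vectors
  is \<open>alg_multiplicity_eq_1_iff\<close>.
\<close>

section \<open>Simple eigenvalues and the characteristic polynomial\<close>

lemma norm_matrix_vector_mult_le:
  fixes A :: "'a::real_normed_field^'n^'m"
  shows "norm (A *v y) \<le> (\<Sum>i\<in>UNIV. \<Sum>j\<in>UNIV. norm (A $ i $ j)) * norm y"
proof -
  have "norm (A *v y) \<le> (\<Sum>i\<in>UNIV. norm ((A *v y) $ i))"
    unfolding norm_vec_def by (rule L2_set_le_sum) simp
  also have "\<dots> \<le> (\<Sum>i\<in>UNIV. \<Sum>j\<in>UNIV. norm (A $ i $ j) * norm y)"
    unfolding matrix_vector_mult_def
    by (auto intro!: sum_mono order.trans[OF norm_sum] mult_left_mono Finite_Cartesian_Product.norm_nth_le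
        simp: norm_mult)
  finally show ?thesis by (simp add: sum_distrib_right)
qed

lemma poly_charpoly: "poly (charpoly A) t = det (mat t - A)"
  by (auto simp: charpoly_def det_def poly_sum poly_prod mat_def map_matrix_def
      intro!: sum.cong prod.cong arg_cong2[where f="(*)"])

lemma mat_mult_vec: "mat t *v y = t *s (y::'a::comm_semiring_1^'n)"
  by (simp add: vec_eq_iff matrix_vector_mult_def mat_def if_distrib[of "\<lambda>a. a * _"] cong: if_cong)

lemma det_nonzero_iff_injective:
  fixes A :: "'a::field^'n^'n"
  shows "det A \<noteq> 0 \<longleftrightarrow> (\<forall>y. A *v y = 0 \<longrightarrow> y = 0)"
  by (simp add: invertible_det_nz[symmetric] invertible_left_inverse matrix_left_invertible_ker)

text \<open>A scalar \<open>t\<close> of modulus larger than the sum of the moduli of the entries is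
  not an eigenvalue, so that the characteristic polynomial does not vanish at
  \<open>t\<close>.\<close>

lemma charpoly_nonzero:
  fixes A :: "'a::real_normed_field^'n^'n"
  shows "charpoly A \<noteq> 0"
proof -
  define c where "c = (\<Sum>i\<in>UNIV. \<Sum>j\<in>UNIV. norm (A $ i $ j))"
  have c: "0 \<le> c" by (auto simp: c_def intro!: sum_nonneg)
  define t :: 'a where "t = of_real (c + 1)"
  have "y = 0" if "(mat t - A) *v y = 0" for y
  proof -
    have "A *v y = t *s y"
      using that by (simp add: matrix_vector_mult_diff_rdistrib mat_mult_vec)
    then have "norm t * norm y \<le> c * norm y"
      using norm_matrix_vector_mult_le[of A y]
      by (simp add: c_def norm_vec_def norm_mult L2_set_right_distrib)
    then show ?thesis using c by (simp add: t_def algebra_simps flip: of_real_add del: of_real_add)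
  qed
  then have "poly (charpoly A) t \<noteq> 0"
    unfolding poly_charpoly det_nonzero_iff_injective by blast
  then show ?thesis by auto
qed

definition replace_column :: "'n \<Rightarrow> 'a^'m \<Rightarrow> 'a^'n^'m \<Rightarrow> 'a^'n^'m" where
  "replace_column i x A = (\<chi> a b. if b = i then x $ a else A $ a $ b)"

lemma replace_column_mult:
  fixes A :: "'a::comm_ring_1^'n^'m"
  shows "replace_column i x A *v y = y $ i *s x + A *v (y - axis i (y $ i))"
  apply (simp add: vec_eq_iff replace_column_def matrix_vector_mult_def axis_def)
  apply (subst (1 2) sum.remove[of _ i])
  apply (auto simp: mult.commute intro!: sum.cong)
  done

lemma det_replace_column_scale:
  fixes A :: "'a::comm_ring_1^'n^'n"
  shows "det (replace_column i (c *s x) A) = c * det (replace_column i x A)"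
proof -
  have t: "transpose (replace_column i y A) = (\<chi> k. if k = i then y else column k A)" for y
    by (simp add: vec_eq_iff transpose_def replace_column_def column_def)
  have "det (transpose (replace_column i (c *s x) A)) = c * det (transpose (replace_column i x A))"
    unfolding t by (rule det_row_mul)
  then show ?thesis by (simp add: det_transpose)
qed

text \<open>Cramer's rule extracts the factor that an eigenvector \<open>x\<close> contributes to
  the characteristic polynomial: replacing column \<open>i\<close> of \<open>t - A\<close> by
  \<open>(t - A) x = (t - z) x\<close> multiplies the determinant by \<open>x $ i\<close>, so
  \<open>x $ i * det (t - A) = (t - z) * q(t)\<close>, where \<open>q(t)\<close> is the determinant
  of \<open>t - A\<close> with column \<open>i\<close> replaced by \<open>x\<close> itself. The root
  \<open>z\<close> is simple if and only if \<open>q(z) \<noteq> 0\<close>. This turns algebraic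
  multiplicity one into the invertibility of a matrix, which can be checked on vectors.\<close>

lemma alg_multiplicity_eq_1_iff:
  fixes A :: "'a::real_normed_field^'n^'n"
  assumes x: "A *v x = z *s x" "x $ i \<noteq> 0"
  shows "alg_multiplicity A z = 1 \<longleftrightarrow> det (replace_column i x (mat z - A)) \<noteq> 0"
proof -
  define q where "q = det (replace_column i (\<chi> a. [:x $ a:]) (mat [:0, 1:] - map_matrix (\<lambda>a. [:a:]) A))"
  have q: "poly q t = det (replace_column i x (mat t - A))" for t
    by (auto simp: q_def replace_column_def det_def poly_sum poly_prod mat_def map_matrix_def
      intro!: sum.cong prod.cong arg_cong2[where f="(*)"])
  have "x $ i * poly (charpoly A) t = (t - z) * poly q t" for t
  proof -
    have "x $ i * poly (charpoly A) t = det (replace_column i ((mat t - A) *v x) (mat t - A))"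
      using cramer_lemma[of i "mat t - A" x] by (simp add: replace_column_def poly_charpoly)
    also have "(mat t - A) *v x = (t - z) *s x"
      by (simp add: matrix_vector_mult_diff_rdistrib mat_mult_vec x vector_sub_rdistrib)
    finally show ?thesis by (simp only: det_replace_column_scale q)
  qed
  then have e: "smult (x $ i) (charpoly A) = [:-z, 1:] * q"
    by (intro poly_eq_poly_eq_iff[THEN iffD1] ext) (simp add: algebra_simps)
  then have "q \<noteq> 0" using charpoly_nonzero[of A] x(2) by auto
  have "alg_multiplicity A z = order z (smult (x $ i) (charpoly A))"
    using x(2) by (simp add: alg_multiplicity_def order_smult)
  also have "\<dots> = Suc (order z q)"
    using order_mult[of "[:-z, 1:]" q z] no_zero_divisors[of "[:-z, 1:]" q] \<open>q \<noteq> 0\<close>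
      order_power_n_n[of z 1] unfolding e by simp
  finally show ?thesis
    using \<open>q \<noteq> 0\<close> order_root[of q z] by (simp add: q)
qed

section \<open>Real vectors and linear forms over the complex numbers\<close>

definition complexify_vec :: "real^'n \<Rightarrow> complex^'n" where
  "complexify_vec v = (\<chi> i. complex_of_real (v $ i))"

lemma complexify_vec_nth [simp]: "complexify_vec v $ i = complex_of_real (v $ i)"
  by (simp add: complexify_vec_def)

lemma complexify_mult_vec: "complexify A *v complexify_vec v = complexify_vec (A *v v)"
  by (simp add: vec_eq_iff complexify_def matrix_vector_mult_def)

lemma transpose_complexify: "transpose (complexify A) = complexify (transpose A)"
  by (simp add: vec_eq_iff complexify_def transpose_def)

lemma complexify_vec_scaleR: "complexify_vec (c *\<^sub>R v) = complex_of_real c *s complexify_vec v"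
  by (simp add: vec_eq_iff)

lemma complexify_vec_eq_0_iff [simp]: "complexify_vec v = 0 \<longleftrightarrow> v = 0"
  by (simp add: vec_eq_iff)

lemma complexify_vec_eq_iff [simp]: "complexify_vec u = complexify_vec v \<longleftrightarrow> u = v"
  by (simp add: vec_eq_iff)

lemma norm_complexify_vec [simp]: "norm (complexify_vec v) = norm v"
  by (simp add: norm_vec_def L2_set_def)

lemma norm_scalar_mult: "norm (c *s y) = norm c * norm (y::'a::real_normed_field^'n)"
  by (simp add: norm_vec_def norm_mult L2_set_right_distrib)

text \<open>The bilinear, not sesquilinear, pairing of coordinate vectors; \<open>pairing f\<close>
  is the linear form with coefficients \<open>f\<close>, also over the complex numbers.\<close>

definition pairing :: "'a::comm_semiring_1^'n \<Rightarrow> 'a^'n \<Rightarrow> 'a" where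
  "pairing f y = (\<Sum>i\<in>UNIV. f $ i * y $ i)"

lemma pairing_add: "pairing f (u + v) = pairing f u + pairing f v"
  by (simp add: pairing_def algebra_simps sum.distrib)

lemma pairing_diff: "pairing f (u - v) = pairing f u - pairing f (v::'a::comm_ring_1^'n)"
  by (simp add: pairing_def algebra_simps sum_subtractf)

lemma pairing_scale: "pairing f (c *s u) = c * pairing f u"
  by (simp add: pairing_def sum_distrib_left mult_ac)

lemma pairing_scale_left: "pairing (c *s f) u = c * pairing f u"
  by (simp add: pairing_def sum_distrib_left mult_ac)

lemma pairing_axis [simp]: "pairing f (axis i 1) = f $ i"
  by (simp add: pairing_def axis_def if_distrib cong: if_cong)

lemma pairing_mult_vec: "pairing f (A *v u) = pairing (transpose A *v f) u"
proof -
  have "pairing f (A *v u) = (\<Sum>i\<in>UNIV. \<Sum>j\<in>UNIV. f $ i * A $ i $ j * u $ j)"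
    by (simp add: pairing_def matrix_vector_mult_def sum_distrib_left mult_ac)
  also have "\<dots> = (\<Sum>j\<in>UNIV. \<Sum>i\<in>UNIV. f $ i * A $ i $ j * u $ j)"
    by (rule sum.swap)
  also have "\<dots> = pairing (transpose A *v f) u"
    unfolding pairing_def matrix_vector_mult_def transpose_def
    by (simp add: sum_distrib_left mult_ac)
  finally show ?thesis .
qed

lemma pairing_complexify: "pairing (complexify_vec f) (complexify_vec y) = complex_of_real (f \<bullet> y)"
  by (simp add: pairing_def inner_vec_def)

section \<open>Dominant eigenvalues\<close>

text \<open>Deflation: \<open>N = A - x (f A)\<close> agrees with \<open>A\<close> on the hyperplane
  \<open>f = 0\<close> up to the direction \<open>x\<close>, and maps everything into that
  hyperplane. Hence an equation \<open>A y = w y + a x\<close>, projected along \<open>x\<close> to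
  the hyperplane, says that the projection of \<open>y\<close> is an eigenvector of \<open>N\<close>
  for \<open>w\<close> or zero; when the modulus of \<open>w\<close> exceeds the sum of the moduli
  of the entries of \<open>N\<close>, it is zero. With \<open>a = 0\<close> this controls the
  eigenvectors of \<open>A\<close>, with \<open>w = l\<close> the generalized eigenvectors above
  \<open>x\<close>.\<close>

lemma deflation_eigenvector:
  fixes A :: "'a::real_normed_field^'n^'n"
  assumes x: "A *v x = l *s x" "pairing f x = 1"
    and small: "(\<Sum>i\<in>UNIV. \<Sum>j\<in>UNIV. norm (A $ i $ j - x $ i * pairing f (column j A))) < norm w"
    and y: "A *v y = w *s y + a *s x"
  shows "y = pairing f y *s x"
proof -
  define N where "N = (\<chi> i j. A $ i $ j - x $ i * pairing f (column j A))"
  have N: "N *v u = A *v u - pairing f (A *v u) *s x" for u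
  proof -
    have "pairing f (A *v u) = (\<Sum>j\<in>UNIV. pairing f (column j A) * u $ j)"
      by (simp add: pairing_mult_vec)
        (simp add: pairing_def vector_matrix_mult_def column_def mult_ac)
    then show ?thesis
      by (simp add: vec_eq_iff N_def matrix_vector_mult_def algebra_simps sum_subtractf sum_distrib_left)
  qed
  \<comment> \<open>The projection of \<open>y\<close> along \<open>x\<close> to the kernel of \<open>f\<close>.\<close>
  define h where "h = y - pairing f y *s x"
  have h0: "pairing f h = 0" by (simp add: h_def pairing_diff pairing_scale x)
  have "A *v h = w *s h + (a + pairing f y * (w - l)) *s x"
    by (simp add: h_def y x vec_eq_iff matrix_vector_mult_diff_distrib vector_scalar_commute algebra_simps)
  then have "N *v h = w *s h"
    by (simp add: N pairing_add pairing_scale h0 x)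
  then have "norm w * norm h \<le> (\<Sum>i\<in>UNIV. \<Sum>j\<in>UNIV. norm (N $ i $ j)) * norm h"
    using norm_matrix_vector_mult_le[of N h] by (simp add: norm_scalar_mult)
  moreover have "(\<Sum>i\<in>UNIV. \<Sum>j\<in>UNIV. norm (N $ i $ j)) < norm w"
    using small by (simp add: N_def)
  ultimately have "h = 0"
    by (metis mult_le_cancel_right_pos not_less zero_less_norm_iff)
  then show ?thesis by (simp add: h_def)
qed

text \<open>A sufficient condition for \<open>l\<close> to be a simple leading eigenvalue that is
  visibly open in \<open>A\<close> and \<open>x\<close>, and unchanged when \<open>A\<close> and
  \<open>l\<close> are multiplied by the same non-zero scalar. Both simplicity and dominance come
  from the deflation argument over the complex numbers.\<close>

lemma dominant_eigenpair_criterion: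
  fixes A :: "real^'n^'n"
  assumes x: "A *v x = l *\<^sub>R x" "f \<bullet> x = 1"
    and small: "(\<Sum>i\<in>UNIV. \<Sum>j\<in>UNIV. \<bar>A $ i $ j - x $ i * (f \<bullet> column j A)\<bar>) < \<bar>l\<bar>"
  shows "simple_leading_eigenvalue A (complex_of_real l)"
    and "{y. A *v y = l *\<^sub>R y} = span {x}"
proof -
  define X F where "X = complexify_vec x" and "F = complexify_vec f"
  have X: "complexify A *v X = complex_of_real l *s X" "pairing F X = 1"
    using x by (simp_all add: X_def F_def complexify_mult_vec complexify_vec_scaleR pairing_complexify)
  have "(\<Sum>i\<in>UNIV. \<Sum>j\<in>UNIV. norm (complexify A $ i $ j - X $ i * pairing F (column j (complexify A))))
      = (\<Sum>i\<in>UNIV. \<Sum>j\<in>UNIV. \<bar>A $ i $ j - x $ i * (f \<bullet> column j A)\<bar>)"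
    by (intro sum.cong refl)
      (simp add: X_def F_def complexify_def pairing_def column_def inner_vec_def
        flip: of_real_mult of_real_sum of_real_diff)
  then have parallel: "y = pairing F y *s X"
    if "complexify A *v y = w *s y + a *s X" "\<bar>l\<bar> \<le> cmod w" for y w a
    using deflation_eigenvector[OF X _ that(1)] small that(2) by simp
  have "x \<noteq> 0" using x(2) by auto
  then have "X \<noteq> 0" by (simp add: X_def)
  then obtain i where i: "X $ i \<noteq> 0" by (auto simp: vec_eq_iff)
  \<comment> \<open>Without its entry \<open>i\<close>, a kernel vector solves \<open>(A - l) h = y $ i X\<close>; deflation makes \<open>h\<close> a
    multiple of \<open>X\<close>, and \<open>h $ i = 0\<close> makes it zero.\<close>
  have "y = 0" if y: "replace_column i X (mat l - complexify A) *v y = 0" for y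
  proof -
    define h where "h = y - axis i (y $ i)"
    have "complexify A *v h = complex_of_real l *s h + y $ i *s X"
      using y by (simp add: replace_column_mult matrix_vector_mult_diff_rdistrib mat_mult_vec
         algebra_simps flip: h_def)
    then have h: "h = pairing F h *s X" by (rule parallel) simp
    have "h $ i = 0" by (simp add: h_def)
    then have "pairing F h = 0" using i h by (metis mult_eq_0_iff vector_smult_component)
    then have "h = 0" using h by simp
    then have "y $ i *s X = 0" using y by (simp add: replace_column_mult flip: h_def)
    then have "y $ i = 0" using \<open>X \<noteq> 0\<close> by (simp add: vec.scale_eq_0_iff)
    then show "y = 0" using \<open>h = 0\<close> by (simp add: h_def)
  qed
  then have "alg_multiplicity (complexify A) l = 1"
    using alg_multiplicity_eq_1_iff[OF X(1) i] det_nonzero_iff_injective by blast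
  moreover have "cmod w < cmod l" if w: "is_eigenvalue (complexify A) w" "w \<noteq> l" for w
  proof (rule ccontr)
    assume c: "\<not> cmod w < cmod l"
    from w obtain v where v: "v \<noteq> 0" "complexify A *v v = w *s v"
      by (auto simp: is_eigenvalue_def)
    have e: "v = pairing F v *s X" using parallel[of v w 0] v c by simp
    have "w *s v = l *s v"
      by (metis e v(2) X(1) vector_scalar_commute vector_smult_assoc mult.commute)
    then show False using v w by (simp add: vec.scale_right_imp_eq)
  qed
  ultimately show "simple_leading_eigenvalue A l"
    using X \<open>X \<noteq> 0\<close> unfolding simple_leading_eigenvalue_def is_eigenvalue_def by blast
  have "y \<in> span {x}" if "A *v y = l *\<^sub>R y" for y
  proof -
    have "complexify_vec y = pairing F (complexify_vec y) *s X"
      using that by (intro parallel[where a = 0 and w = l])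
        (simp_all add: complexify_mult_vec complexify_vec_scaleR)
    then have "complexify_vec y = complexify_vec ((f \<bullet> y) *\<^sub>R x)"
      by (simp add: X_def F_def pairing_complexify complexify_vec_scaleR)
    then have "y = (f \<bullet> y) *\<^sub>R x" by (simp only: complexify_vec_eq_iff)
    then show ?thesis by (metis span_base span_scale insertI1)
  qed
  moreover have "A *v y = l *\<^sub>R y" if "y \<in> span {x}" for y
    using that x(1) by (auto simp: span_singleton matrix_vector_mult_scaleR)
  ultimately show "{y. A *v y = l *\<^sub>R y} = span {x}" by blast
qed

text \<open>A left eigenvector \<open>f\<close> for the leading eigenvalue does not vanish on the
  right eigenvector \<open>x\<close>: otherwise \<open>f\<close> would annihilate all columns of the
  invertible matrix obtained from \<open>l - A\<close> by putting \<open>x\<close> in a column. So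
  the kernel of \<open>f\<close> is an invariant complement of the eigenline, and \<open>l\<close>
  is not an eigenvalue on it.\<close>

lemma simple_leading_eigenvalue_left_eigenvector:
  fixes A :: "real^'n^'n"
  assumes l: "simple_leading_eigenvalue A (complex_of_real l)" and x: "A *v x = l *\<^sub>R x" "x \<noteq> 0"
  obtains f where "f \<bullet> x = 1" "transpose A *v f = l *\<^sub>R f"
    and "\<And>h w. h \<noteq> 0 \<Longrightarrow> pairing (complexify_vec f) h = 0 \<Longrightarrow> complexify A *v h = w *s h \<Longrightarrow> cmod w < \<bar>l\<bar>"
proof -
  define X where "X = complexify_vec x"
  have X: "complexify A *v X = complex_of_real l *s X" "X \<noteq> 0"
    using x by (simp_all add: X_def complexify_mult_vec complexify_vec_scaleR)
  then obtain i where i: "X $ i \<noteq> 0" by (auto simp: vec_eq_iff)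
  let ?D = "mat (complex_of_real l) - complexify A"
  have D: "det (replace_column i X ?D) \<noteq> 0"
    using l alg_multiplicity_eq_1_iff[OF X(1) i] by (simp add: simple_leading_eigenvalue_def)
  have "det (mat l - A) = 0"
    using x det_nonzero_iff_injective[of "mat l - A"]
    by (auto simp: matrix_vector_mult_diff_rdistrib mat_mult_vec scalar_mult_eq_scaleR)
  then have "det (transpose (mat l - A)) = 0" by (simp add: det_transpose)
  then obtain g where "transpose (mat l - A) *v g = 0" "g \<noteq> 0"
    using det_nonzero_iff_injective by blast
  moreover have "transpose (mat l - A) = mat l - transpose A"
    by (simp add: vec_eq_iff transpose_def mat_def)
  ultimately have g: "transpose A *v g = l *\<^sub>R g" "g \<noteq> 0"
    by (simp_all add: matrix_vector_mult_diff_rdistrib mat_mult_vec scalar_mult_eq_scaleR del: transpose_matrix_vector)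
  define G where "G = complexify_vec g"
  have G: "transpose (complexify A) *v G = complex_of_real l *s G"
    using g by (simp add: G_def transpose_complexify complexify_mult_vec complexify_vec_scaleR del: transpose_matrix_vector)
  have gx: "g \<bullet> x \<noteq> 0"
  proof
    assume 0: "g \<bullet> x = 0"
    have "pairing G (?D *v u) = 0" for u
      by (simp add: matrix_vector_mult_diff_rdistrib mat_mult_vec pairing_diff pairing_scale
          pairing_mult_vec G pairing_scale_left del: transpose_matrix_vector)
    moreover have "pairing G X = 0" using 0 by (simp add: G_def X_def pairing_complexify)
    ultimately have "pairing G (replace_column i X ?D *v y) = 0" for y
      by (simp add: replace_column_mult pairing_add pairing_scale)
    then have "pairing (transpose (replace_column i X ?D) *v G) y = 0" for y
      by (simp add: pairing_mult_vec del: transpose_matrix_vector)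
    then have "transpose (replace_column i X ?D) *v G = 0"
      by (metis pairing_axis vec_eq_iff zero_index)
    then show False
      using D det_nonzero_iff_injective[of "transpose (replace_column i X ?D)"] g
      by (auto simp: det_transpose G_def)
  qed
  show thesis
  proof
    show "(inverse (g \<bullet> x) *\<^sub>R g) \<bullet> x = 1" using gx by simp
    show "transpose A *v (inverse (g \<bullet> x) *\<^sub>R g) = l *\<^sub>R (inverse (g \<bullet> x) *\<^sub>R g)"
      using g(1) by (simp add: matrix_vector_mult_scaleR del: transpose_matrix_vector)
    fix h w
    assume h: "h \<noteq> 0" "pairing (complexify_vec (inverse (g \<bullet> x) *\<^sub>R g)) h = 0" "complexify A *v h = w *s h"
    have "pairing G h = 0"
      using h(2) gx by (simp add: pairing_def G_def mult.assoc flip: sum_distrib_left)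
    have "w \<noteq> l"
    proof
      assume w: "w = l"
      define k where "k = h - (h $ i / X $ i) *s X"
      have k: "k $ i = 0" "?D *v k = 0"
        using i by (simp_all add: k_def matrix_vector_mult_diff_rdistrib mat_mult_vec
          matrix_vector_mult_diff_distrib X h w vector_scalar_commute mult.commute)
      have "k - axis i (k $ i) = k" by (simp add: k axis_def vec_eq_iff)
      then have "replace_column i X ?D *v k = 0"
        using k by (simp only: replace_column_mult) simp
      then have "k = 0" using D det_nonzero_iff_injective by blast
      then have "h = (h $ i / X $ i) *s X" by (simp add: k_def)
      then have "pairing G h = (h $ i / X $ i) * pairing G X" by (metis pairing_scale)
      then show False
        using \<open>pairing G h = 0\<close> gx h(1) \<open>h = _\<close> i
        by (auto simp: G_def X_def pairing_complexify)
    qed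
    then show "cmod w < \<bar>l\<bar>"
      using l h unfolding simple_leading_eigenvalue_def is_eigenvalue_def by fastforce
  qed
qed

section \<open>Decay of powers\<close>

text \<open>A contraction with a vanishing perturbation forgets its initial value.\<close>

lemma affine_recurrence_tendsto_0:
  fixes a e :: "nat \<Rightarrow> 'a::real_normed_vector"
  assumes rec: "\<And>k. norm (a (Suc k)) \<le> r * norm (a k) + norm (e k)"
    and r: "0 \<le> r" "r < 1" and e: "e \<longlonglongrightarrow> 0"
  shows "a \<longlonglongrightarrow> 0"
proof (rule LIMSEQ_I)
  fix d :: real assume "0 < d"
  define c where "c = d / 2 * (1 - r)"
  have "0 < c" using \<open>0 < d\<close> r by (simp add: c_def)
  then obtain K where K: "\<And>k. k \<ge> K \<Longrightarrow> norm (e k) < c"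
    using LIMSEQ_D[OF e, of c] by auto
  have step: "norm (a (K + j)) \<le> r ^ j * norm (a K) + d / 2" for j
  proof (induction j)
    case 0
    show ?case using \<open>0 < d\<close> by simp
  next
    case (Suc j)
    have "norm (a (K + Suc j)) \<le> r * norm (a (K + j)) + c"
      using rec[of "K + j"] K[of "K + j"] by simp
    also have "\<dots> \<le> r * (r ^ j * norm (a K) + d / 2) + c"
      using Suc r by (simp add: mult_left_mono)
    also have "\<dots> = r ^ Suc j * norm (a K) + d / 2"
      by (simp add: c_def field_simps)
    finally show ?case .
  qed
  have "(\<lambda>j. r ^ j * norm (a K)) \<longlonglongrightarrow> 0 * norm (a K)"
    using r by (intro tendsto_mult LIMSEQ_power_zero tendsto_const) auto
  then obtain J where J: "\<And>j. j \<ge> J \<Longrightarrow> r ^ j * norm (a K) < d / 2"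
    using LIMSEQ_D[of _ 0 "d/2"] \<open>0 < d\<close> by fastforce
  have "norm (a k - 0) < d" if "k \<ge> K + J" for k
  proof -
    have "J \<le> k - K" using that by simp
    then show ?thesis using step[of "k - K"] J[of "k - K"] that by simp
  qed
  then show "\<exists>n0. \<forall>n\<ge>n0. norm (a n - 0) < d" by blast
qed

text \<open>The vector \<open>p(T) y\<close>, by Horner's scheme.\<close>

definition poly_act :: "'a::field^'n^'n \<Rightarrow> 'a^'n \<Rightarrow> 'a poly \<Rightarrow> 'a^'n" where
  "poly_act T y p = fold_coeffs (\<lambda>a v. a *s y + T *v v) p 0"

lemma poly_act_0 [simp]: "poly_act T y 0 = 0"
  by (simp add: poly_act_def)

lemma poly_act_pCons [simp]: "poly_act T y (pCons a p) = a *s y + T *v poly_act T y p"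
  by (cases "a = 0 \<and> p = 0") (auto simp: poly_act_def)

lemma poly_act_add: "poly_act T y (p + q) = poly_act T y p + poly_act T y q"
  by (induction p q rule: poly_induct2)
    (simp_all add: matrix_vector_right_distrib algebra_simps vector_sadd_rdistrib)

lemma poly_act_smult: "poly_act T y (smult c p) = c *s poly_act T y p"
  by (induction p) (simp_all add: vector_scalar_commute vector_add_ldistrib vector_smult_assoc)

lemma poly_act_linear_factor: "poly_act T y ([:- c, 1:] * q) = T *v poly_act T y q - c *s poly_act T y q"
proof -
  have "[:- c, 1:] * q = pCons 0 q + smult (- c) q" by simp
  then show ?thesis by (simp only: poly_act_add poly_act_smult poly_act_pCons) simp
qed

lemma poly_act_shift: "poly_act T (T *v y - c *s y) q = T *v poly_act T y q - c *s poly_act T y q"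
  by (induction q) (simp_all add: matrix_vector_right_distrib matrix_vector_mult_diff_distrib
    vector_scalar_commute vector_ssub_ldistrib vector_add_ldistrib vector_smult_assoc mult.commute)

lemma poly_act_sum: "poly_act T y (sum p S) = (\<Sum>i\<in>S. poly_act T y (p i))"
  by (induction S rule: infinite_finite_induct) (simp_all add: poly_act_add)

lemma poly_act_monom: "poly_act T y (monom c i) = c *s (((*v) T ^^ i) y)"
  by (induction i) (simp_all add: monom_0 monom_Suc vector_scalar_commute)

text \<open>The vectors \<open>y, T y, T\<^sup>2 y, \<dots>\<close> live in a finite-dimensional
  space, so they satisfy a linear relation.\<close>

lemma annihilating_polynomial:
  fixes T :: "'a::field^'n^'n"
  obtains p where "p \<noteq> 0" "poly_act T y p = 0"
proof -
  define s where "s i = ((*v) T ^^ i) y" for i :: nat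
  show thesis
  proof (cases "inj s")
    case False
    then obtain i j where "i \<noteq> j" "s i = s j" by (auto simp: inj_def)
    moreover have "monom 1 i - monom 1 j \<noteq> (0 :: 'a poly)"
      using \<open>i \<noteq> j\<close> by (metis coeff_monom eq_iff_diff_eq_0 zero_neq_one)
    moreover have "poly_act T y (monom 1 i - monom 1 j) = s i - s j"
      using poly_act_add[of T y "monom 1 i - monom 1 j" "monom 1 j"]
      by (simp add: poly_act_monom s_def)
    ultimately show thesis using that[of "monom 1 i - monom 1 j"] by simp
  next
    case True
    define S where "S = s ` {..CARD('n)}"
    have "card S = Suc (CARD('n))" using True by (simp add: S_def card_image inj_on_subset)
    moreover have "vec.dim (UNIV :: ('a^'n) set) = CARD('n)"
      by (simp only: vec.dim_UNIV card_cart_basis)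
    ultimately have "vec.dependent S"
      using vec.independent_card_le_dim[of S UNIV] by (metis Suc_n_not_le_n subset_UNIV)
    then obtain u where u: "(\<Sum>v\<in>S. u v *s v) = 0" "\<exists>v\<in>S. u v \<noteq> 0"
      using vec.dependent_finite[of S] by (auto simp: S_def)
    define p where "p = (\<Sum>i\<le>CARD('n). monom (u (s i)) i)"
    have "poly_act T y p = (\<Sum>i\<le>CARD('n). u (s i) *s s i)"
      by (simp add: p_def poly_act_sum poly_act_monom s_def)
    also have "\<dots> = (\<Sum>v\<in>S. u v *s v)"
      using True by (simp add: S_def sum.reindex inj_on_subset)
    finally have "poly_act T y p = 0" using u by simp
    moreover obtain i where "i \<le> CARD('n)" "u (s i) \<noteq> 0" using u(2) by (auto simp: S_def)
    then have "coeff p i \<noteq> 0" by (simp add: p_def coeff_sum)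
    then have "p \<noteq> 0" by auto
    ultimately show thesis using that by blast
  qed
qed

text \<open>The spectral radius governs the growth of powers. Instead of a Jordan normal form, the
  proof splits off one linear factor \<open>T - w\<close> at a time from a polynomial annihilating
  \<open>y\<close>. The vector \<open>(T - w) y\<close> is annihilated by a polynomial of smaller
  degree, so its scaled orbit tends to zero, and the scaled orbit of \<open>y\<close> follows it
  through an affine recurrence with ratio \<open>w / z\<close>. Either \<open>w\<close> is an
  eigenvalue on \<open>U\<close>, so that this ratio is a contraction, or the factor is
  superfluous.\<close>

lemma powers_tendsto_0:
  fixes T :: "complex^'n^'n"
  assumes U: "vec.subspace U" "\<And>h. h \<in> U \<Longrightarrow> T *v h \<in> U"
    and eig: "\<And>h w. h \<in> U \<Longrightarrow> h \<noteq> 0 \<Longrightarrow> T *v h = w *s h \<Longrightarrow> cmod w < cmod z"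
    and y: "y \<in> U" and z: "z \<noteq> 0"
  shows "(\<lambda>k. (1 / z ^ k) *s (((*v) T ^^ k) y)) \<longlonglongrightarrow> 0"
proof -
  have act: "poly_act T y q \<in> U" if "y \<in> U" for y q
    using that U by (induction q) (auto intro: vec.subspace_add vec.subspace_scale vec.subspace_0)
  have "(\<lambda>k. (1 / z ^ k) *s (((*v) T ^^ k) y)) \<longlonglongrightarrow> 0"
    if "p \<noteq> 0" "poly_act T y p = 0" "y \<in> U" for p y
    using that
  proof (induction "degree p" arbitrary: p y rule: less_induct)
    case less
    show ?case
    proof (cases "degree p = 0")
      case True
      then obtain c where "p = [:c:]" by (metis degree_eq_zeroE)
      with less.prems have "y = 0" by (simp add: vec.scale_eq_0_iff)
      have "((*v) T ^^ k) 0 = 0" for k by (induction k) auto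
      then show ?thesis by (simp add: \<open>y = 0\<close>)
    next
      case False
      then obtain w where "poly p w = 0"
        using fundamental_theorem_of_algebra constant_degree by metis
      then obtain q where p: "p = [:- w, 1:] * q" by (metis dvdE poly_eq_0_iff_dvd)
      then have "q \<noteq> 0" using less.prems(1) by auto
      then have deg: "degree q < degree p" unfolding p by (subst degree_mult_eq) auto
      have zero: "T *v poly_act T y q = w *s poly_act T y q"
        using less.prems(2) unfolding p poly_act_linear_factor by simp
      show ?thesis
      proof (cases "poly_act T y q = 0")
        case True
        then show ?thesis using less.hyps deg \<open>q \<noteq> 0\<close> less.prems(3) by blast
      next
        case False
        then have w: "cmod w < cmod z" using eig act less.prems(3) zero by blast
        define y' where "y' = T *v y - w *s y"
        have "y' \<in> U" using U less.prems(3)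
          by (auto simp: y'_def intro: vec.subspace_diff vec.subspace_scale)
        moreover have "poly_act T y' q = 0" by (simp add: y'_def poly_act_shift zero)
        ultimately have "(\<lambda>k. (1 / z ^ k) *s (((*v) T ^^ k) y')) \<longlonglongrightarrow> 0"
          using less.hyps deg \<open>q \<noteq> 0\<close> by blast
        then have "(\<lambda>k. norm (1 / z) * norm ((1 / z ^ k) *s (((*v) T ^^ k) y'))) \<longlonglongrightarrow> norm (1 / z) * 0"
          by (intro tendsto_mult tendsto_const tendsto_norm_zero)
        then have e: "(\<lambda>k. norm ((1 / z) *s ((1 / z ^ k) *s (((*v) T ^^ k) y')))) \<longlonglongrightarrow> 0"
          by (simp only: norm_scalar_mult[of "1 / z"] mult_zero_right)
        show ?thesis
        proof (rule affine_recurrence_tendsto_0[where r = "cmod (w / z)"])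
          show "(\<lambda>k. (1 / z) *s ((1 / z ^ k) *s (((*v) T ^^ k) y'))) \<longlonglongrightarrow> 0"
            using e by (rule tendsto_norm_zero_cancel)
          fix k
          have "((*v) T ^^ k) y' = ((*v) T ^^ Suc k) y - w *s (((*v) T ^^ k) y)"
            by (induction k) (simp_all add: y'_def matrix_vector_mult_diff_distrib vector_scalar_commute)
          then have step: "((*v) T ^^ Suc k) y = ((*v) T ^^ k) y' + w *s (((*v) T ^^ k) y)"
            by simp
          have c: "1 / z ^ Suc k = 1 / z * (1 / z ^ k)" "1 / z * (1 / z ^ k) * w = w / z * (1 / z ^ k)"
            by simp_all
          have "(1 / z ^ Suc k) *s (((*v) T ^^ Suc k) y)
              = (w / z) *s ((1 / z ^ k) *s (((*v) T ^^ k) y)) + (1 / z) *s ((1 / z ^ k) *s (((*v) T ^^ k) y'))"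
            by (simp only: step vector_add_ldistrib vector_smult_assoc c add.commute)
          then show "norm ((1 / z ^ Suc k) *s (((*v) T ^^ Suc k) y))
              \<le> cmod (w / z) * norm ((1 / z ^ k) *s (((*v) T ^^ k) y)) + norm ((1 / z) *s ((1 / z ^ k) *s (((*v) T ^^ k) y')))"
            by (metis norm_scalar_mult norm_triangle_ineq)
        qed (use w z in \<open>simp_all add: norm_divide\<close>)
      qed
    qed
  qed
  moreover obtain p where "p \<noteq> 0" "poly_act T y p = 0"
    by (rule annihilating_polynomial)
  ultimately show ?thesis using y by blast
qed

section \<open>Attracting fixed points are limit points\<close>

definition rank_one_matrix :: "real^'m \<Rightarrow> real^'n \<Rightarrow> real^'n^'m" where
  "rank_one_matrix x f = (\<chi> i j. x $ i * f $ j)"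

lemma rank_one_matrix_mult_vec [simp]: "rank_one_matrix x f *v y = (f \<bullet> y) *\<^sub>R x"
  by (simp add: vec_eq_iff rank_one_matrix_def matrix_vector_mult_def inner_vec_def
    sum_distrib_left mult_ac)

lemma rank_one_matrix:
  assumes "f \<bullet> x = 1"
  shows "range (\<lambda>y. rank_one_matrix x f *v y) = span {x}" "rank (rank_one_matrix x f) = 1"
proof -
  have "c *\<^sub>R x \<in> range (\<lambda>y. rank_one_matrix x f *v y)" for c
    using assms by (intro range_eqI[of _ _ "c *\<^sub>R x"]) simp
  then show *: "range (\<lambda>y. rank_one_matrix x f *v y) = span {x}"
    by (auto simp: span_singleton)
  have "x \<noteq> 0" using assms by auto
  then show "rank (rank_one_matrix x f) = 1"
    unfolding rank_dim_range * by simp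
qed

lemma power_mult_vec: "(((**) A ^^ k) A) *v y = ((*v) A ^^ Suc k) y"
  by (induction k) (simp_all flip: matrix_vector_mul_assoc)

lemma power_in_generated_semigroup:
  "A \<in> generated_semigroup \<A> \<Longrightarrow> ((**) A ^^ k) A \<in> generated_semigroup \<A>"
  by (induction k) (auto intro: generated_semigroup.product)

lemma complexify_power_mult_vec:
  "((*v) (complexify A) ^^ k) (complexify_vec y) = complexify_vec (((*v) A ^^ k) y)"
  by (induction k) (simp_all add: complexify_mult_vec)

lemma power_mult_vec_linear:
  fixes A :: "real^'n^'n"
  shows "((*v) A ^^ k) (c *\<^sub>R x + h) = c *\<^sub>R ((*v) A ^^ k) x + ((*v) A ^^ k) h"
  by (induction k) (simp_all add: matrix_vector_right_distrib matrix_vector_mult_scaleR)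

text \<open>On the eigenline, \<open>A / l\<close> is the identity; on the invariant complement
  \<open>f = 0\<close>, all its eigenvalues have modulus less than one. So its powers converge to
  the projection to the eigenline along that complement. The index is shifted because only positive
  powers of \<open>A\<close> belong to the semigroup that \<open>A\<close> generates.\<close>

lemma proximal_powers_tendsto:
  fixes A :: "real^'n^'n"
  assumes l: "simple_leading_eigenvalue A (complex_of_real l)" and x: "A *v x = l *\<^sub>R x" "x \<noteq> 0" and "l \<noteq> 0"
  obtains f where "f \<bullet> x = 1"
    "(\<lambda>k. (1 / l ^ Suc k) *\<^sub>R ((**) A ^^ k) A) \<longlonglongrightarrow> rank_one_matrix x f"
proof -
  obtain f where f: "f \<bullet> x = 1" "transpose A *v f = l *\<^sub>R f"
    and small: "\<And>h w. h \<noteq> 0 \<Longrightarrow> pairing (complexify_vec f) h = 0 \<Longrightarrow> complexify A *v h = w *s h \<Longrightarrow> cmod w < \<bar>l\<bar>"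
    using simple_leading_eigenvalue_left_eigenvector[OF l x] by blast
  define F where "F = complexify_vec f"
  define U where "U = {h. pairing F h = 0}"
  have F: "transpose (complexify A) *v F = complex_of_real l *s F"
    using f by (simp add: F_def transpose_complexify complexify_mult_vec complexify_vec_scaleR del: transpose_matrix_vector)
  have pow_x: "((*v) A ^^ k) x = l ^ k *\<^sub>R x" for k
    by (induction k) (simp_all add: x matrix_vector_mult_scaleR)
  have kernel: "(\<lambda>k. (1 / l ^ k) *\<^sub>R ((*v) A ^^ k) h) \<longlonglongrightarrow> 0" if "f \<bullet> h = 0" for h
  proof -
    have "(\<lambda>k. (1 / complex_of_real l ^ k) *s ((*v) (complexify A) ^^ k) (complexify_vec h)) \<longlonglongrightarrow> 0"
    proof (rule powers_tendsto_0[where U = U])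
      show "vec.subspace U"
        by (auto simp: U_def vec.subspace_def pairing_add pairing_scale) (simp add: pairing_def)
      show "complexify A *v h \<in> U" if "h \<in> U" for h
        using that by (simp add: U_def pairing_mult_vec F pairing_scale_left del: transpose_matrix_vector)
      show "complexify_vec h \<in> U" using that by (simp add: U_def F_def pairing_complexify)
    qed (use small \<open>l \<noteq> 0\<close> in \<open>auto simp: U_def F_def\<close>)
    from tendsto_norm[OF this] show ?thesis
      by (intro tendsto_norm_zero_cancel[of "\<lambda>k. (1 / l ^ k) *\<^sub>R ((*v) A ^^ k) h"])
        (simp add: complexify_power_mult_vec norm_scalar_mult norm_divide norm_power power_abs)
  qed
  have "(\<lambda>k. ((1 / l ^ Suc k) *\<^sub>R ((**) A ^^ k) A) *v axis j 1) \<longlonglongrightarrow> f $ j *\<^sub>R x" for j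
  proof -
    \<comment> \<open>The component of the basis vector in the invariant complement.\<close>
    define h where "h = axis j 1 - f $ j *\<^sub>R x"
    have "f \<bullet> h = 0" using f by (simp add: h_def inner_diff_right inner_axis)
    from LIMSEQ_Suc[OF kernel[OF this]]
    have "(\<lambda>k. f $ j *\<^sub>R x + (1 / l ^ Suc k) *\<^sub>R ((*v) A ^^ Suc k) h) \<longlonglongrightarrow> f $ j *\<^sub>R x + 0"
      by (intro tendsto_add tendsto_const)
    moreover have "((1 / l ^ Suc k) *\<^sub>R ((**) A ^^ k) A) *v axis j 1
        = f $ j *\<^sub>R x + (1 / l ^ Suc k) *\<^sub>R ((*v) A ^^ Suc k) h" for k
    proof -
      have "((1 / l ^ Suc k) *\<^sub>R ((**) A ^^ k) A) *v axis j 1 = (1 / l ^ Suc k) *\<^sub>R ((*v) A ^^ Suc k) (axis j 1)"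
        by (simp only: scaleR_matrix_vector_assoc[symmetric] power_mult_vec)
      also have "\<dots> = (1 / l ^ Suc k) *\<^sub>R ((*v) A ^^ Suc k) (f $ j *\<^sub>R x + h)"
        by (simp add: h_def)
      also have "\<dots> = f $ j *\<^sub>R x + (1 / l ^ Suc k) *\<^sub>R ((*v) A ^^ Suc k) h"
        using \<open>l \<noteq> 0\<close> by (simp only: power_mult_vec_linear pow_x scaleR_add_right) simp
      finally show ?thesis .
    qed
    ultimately show ?thesis by simp
  qed
  then have "(\<lambda>k. (((1 / l ^ Suc k) *\<^sub>R ((**) A ^^ k) A) *v axis j 1) $ i) \<longlonglongrightarrow> (f $ j *\<^sub>R x) $ i" for i j
    by (rule tendsto_vec_nth)
  then have "(\<lambda>k. (1 / l ^ Suc k) *\<^sub>R ((**) A ^^ k) A) \<longlonglongrightarrow> rank_one_matrix x f"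
    by (intro vec_tendstoI) (simp add: matrix_vector_mul_component inner_axis rank_one_matrix_def mult.commute)
  with f that show thesis by blast
qed

abbreviation semigroup_cone :: "(real^'n^'n) set \<Rightarrow> (real^'n^'n) set" where
  "semigroup_cone \<A> \<equiv> {k *\<^sub>R A |k A. A \<in> generated_semigroup \<A>}"

lemma attracting_fixed_point_in_limit_set:
  assumes A: "A \<in> generated_semigroup \<A>" "det A \<noteq> 0" and p: "is_attracting_fixed_point A p"
  shows "p \<in> limit_set \<A>"
proof -
  obtain l where l: "simple_leading_eigenvalue A (complex_of_real l)" "line_of p = {x. A *v x = l *\<^sub>R x}"
    using p by (auto simp: is_attracting_fixed_point_def)
  define x where "x = unit_direction p"
  have x: "x \<in> line_of p" "x \<noteq> 0" using unit_direction[of p] by (auto simp: x_def)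
  then have Ax: "A *v x = l *\<^sub>R x" using l by simp
  have "l \<noteq> 0" using Ax x A(2) by (auto simp: det_nonzero_iff_injective)
  obtain f where f: "f \<bullet> x = 1"
    "(\<lambda>k. (1 / l ^ Suc k) *\<^sub>R ((**) A ^^ k) A) \<longlonglongrightarrow> rank_one_matrix x f"
    using proximal_powers_tendsto[OF l(1) Ax x(2) \<open>l \<noteq> 0\<close>] by blast
  have "(1 / l ^ Suc k) *\<^sub>R ((**) A ^^ k) A \<in> semigroup_cone \<A>" for k
    using power_in_generated_semigroup[OF A(1)] by blast
  with f(2) have "rank_one_matrix x f \<in> closure (semigroup_cone \<A>)"
    unfolding closure_sequential by (intro exI conjI allI)
  then show ?thesis
    using rank_one_matrix[OF f(1)] line_of_span[OF x] unfolding limit_set_def by blast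
qed

lemma generated_semigroup_det_1:
  assumes "\<And>A. A \<in> \<A> \<Longrightarrow> det A = 1" "A \<in> generated_semigroup \<A>"
  shows "det A = 1"
  using assms(2) by induction (simp_all add: assms(1) det_mul)

section \<open>The limit set is closed\<close>

lemma subspace_line_of: "subspace (line_of p)" and dim_line_of: "dim (line_of p) = 1"
  using line_of[of p] by auto

lemma cos_dist_projective_space: "cos (dist p q) = \<bar>unit_direction p \<bullet> unit_direction q\<bar>"
  using Cauchy_Schwarz_ineq2[of "unit_direction p" "unit_direction q"]
  by (simp add: dist_projective_space_def unit_direction cos_arccos_abs)

text \<open>Projecting \<open>x n\<close> to \<open>q\<close> loses only the factor cosine of the
  angle, which tends to one; so the limit is as long as its projection to \<open>q\<close>, the
  equality case of the Cauchy-Schwarz inequality.\<close>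

lemma limit_in_limit_line:
  assumes x: "\<And>n. x n \<in> line_of (p n)" "x \<longlonglongrightarrow> y" and p: "p \<longlonglongrightarrow> q"
  shows "y \<in> line_of q"
proof -
  define u where "u = unit_direction q"
  have u: "u \<in> line_of q" "norm u = 1" by (simp_all add: u_def unit_direction)
  have "\<bar>x n \<bullet> u\<bar> = norm (x n) * cos (dist (p n) q)" for n
  proof -
    have "x n \<in> span {unit_direction (p n)}"
      using x(1)[of n] unit_direction[of "p n"] line_of_span by fastforce
    then obtain c where "x n = c *\<^sub>R unit_direction (p n)" by (auto simp: span_singleton)
    then show ?thesis by (simp add: cos_dist_projective_space abs_mult unit_direction u_def)
  qed
  moreover have "(\<lambda>n. norm (x n) * cos (dist (p n) q)) \<longlonglongrightarrow> norm y * cos (dist q q)"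
    by (intro tendsto_intros x p)
  moreover have "(\<lambda>n. \<bar>x n \<bullet> u\<bar>) \<longlonglongrightarrow> \<bar>y \<bullet> u\<bar>" by (intro tendsto_intros x)
  ultimately have "\<bar>y \<bullet> u\<bar> = norm y * norm u"
    using LIMSEQ_unique u by fastforce
  then have "y = norm y *\<^sub>R u \<or> y = - (norm y *\<^sub>R u)"
    unfolding norm_cauchy_schwarz_abs_eq using u by auto
  then show ?thesis
    using u subspace_line_of[of q] by (metis subspace_neg subspace_scale)
qed

lemma dist_lines_small:
  assumes v: "v \<in> line_of p" "v \<noteq> 0" and "0 < e"
  obtains d where "0 < d"
    "\<And>x q. dist x v < d \<Longrightarrow> x \<in> line_of q \<Longrightarrow> x \<noteq> 0 \<Longrightarrow> dist q p < e"
proof -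
  \<comment> \<open>The cosine is strictly decreasing only up to \<open>pi\<close>.\<close>
  define r where "r = min e 1"
  have r: "0 < r" "r < pi" "r \<le> e" using \<open>0 < e\<close> pi_gt3 by (auto simp: r_def)
  then have "cos r < 1" using cos_monotone_0_pi[of 0 r] by simp
  define h where "h x = \<bar>x \<bullet> v\<bar> / (norm x * norm v)" for x
  have "isCont h v" unfolding h_def using v by (intro continuous_intros) auto
  moreover have "h v = 1" using v by (simp add: h_def dot_square_norm power2_eq_square)
  ultimately have "\<forall>\<^sub>F x in nhds v. cos r < h x"
    using \<open>cos r < 1\<close> by (simp add: continuous_within order_tendstoD(1) tendsto_nhds_iff flip: tendsto_at_iff_tendsto_nhds)
  then obtain d where d: "0 < d" "\<And>x. dist x v < d \<Longrightarrow> cos r < h x"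
    by (auto simp: eventually_nhds_metric)
  show thesis
  proof
    fix x q assume x: "dist x v < d" "x \<in> line_of q" "x \<noteq> 0"
    have "h x \<le> 1" using Cauchy_Schwarz_ineq2[of x v] v x by (simp add: h_def divide_le_eq)
    have "dist q p = arccos (h x)"
      unfolding h_def using x v by (intro dist_projective_space_angle) auto
    also have "\<dots> < arccos (cos r)"
      using d(2)[OF x(1)] \<open>h x \<le> 1\<close> by (intro arccos_less_arccos) auto
    also have "\<dots> = r" using r by (intro arccos_cos) auto
    finally show "dist q p < e" using r by simp
  qed (use d in auto)
qed

lemma closure_semigroup_cone_scale:
  assumes "\<pi> \<in> closure (semigroup_cone \<A>)"
  shows "c *\<^sub>R \<pi> \<in> closure (semigroup_cone \<A>)"
proof -
  have "(\<lambda>M. c *\<^sub>R M) ` closure (semigroup_cone \<A>) \<subseteq> closure (semigroup_cone \<A>)"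
  proof (rule image_closure_subset)
    have "c *\<^sub>R M \<in> semigroup_cone \<A>" if "M \<in> semigroup_cone \<A>" for M
    proof -
      from that obtain k A where "M = k *\<^sub>R A" "A \<in> generated_semigroup \<A>" by blast
      then have "c *\<^sub>R M = (c * k) *\<^sub>R A" "A \<in> generated_semigroup \<A>" by simp_all
      then show ?thesis by blast
    qed
    then show "(\<lambda>M. c *\<^sub>R M) ` semigroup_cone \<A> \<subseteq> closure (semigroup_cone \<A>)"
      using closure_subset by blast
  qed (auto intro: continuous_intros)
  then show ?thesis using assms by blast
qed

lemma continuous_on_matrix_mult_const:
  fixes B :: "real^'n^'m"
  shows "continuous_on S (\<lambda>M::real^'m^'k. M ** B)"
  unfolding matrix_matrix_mult_def by (intro continuous_intros)

lemma closure_semigroup_cone_mult_right: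
  assumes "\<pi> \<in> closure (semigroup_cone \<A>)" and B: "B \<in> generated_semigroup \<A>"
  shows "\<pi> ** B \<in> closure (semigroup_cone \<A>)"
proof -
  have "(\<lambda>M. M ** B) ` closure (semigroup_cone \<A>) \<subseteq> closure (semigroup_cone \<A>)"
  proof (rule image_closure_subset)
    have "M ** B \<in> semigroup_cone \<A>" if "M \<in> semigroup_cone \<A>" for M
    proof -
      from that obtain k A where "M = k *\<^sub>R A" "A \<in> generated_semigroup \<A>" by blast
      then have "M ** B = k *\<^sub>R (A ** B)" "A ** B \<in> generated_semigroup \<A>"
        using B generated_semigroup.product by (auto simp: scalar_matrix_assoc)
      then show ?thesis by blast
    qed
    then show "(\<lambda>M. M ** B) ` semigroup_cone \<A> \<subseteq> closure (semigroup_cone \<A>)"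
      using closure_subset by blast
  qed (auto intro: continuous_on_matrix_mult_const)
  then show ?thesis using assms by blast
qed

lemma rank_one_range_eq_line:
  fixes \<sigma> :: "real^'n^'m"
  assumes "\<sigma> \<noteq> 0" "range (\<lambda>x. \<sigma> *v x) \<subseteq> line_of p"
  shows "rank \<sigma> = 1" "line_of p = range (\<lambda>x. \<sigma> *v x)"
proof -
  have "rank \<sigma> \<noteq> 0" using assms by (simp add: rank_eq_0)
  moreover have "rank \<sigma> \<le> 1"
    unfolding rank_dim_range using dim_subset[OF assms(2)] dim_line_of by metis
  ultimately show r: "rank \<sigma> = 1" by simp
  have "subspace (range (\<lambda>x. \<sigma> *v x))"
    by (intro linear_subspace_image subspace_UNIV matrix_vector_mul_linear)
  then show "line_of p = range (\<lambda>x. \<sigma> *v x)"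
    using subspace_dim_equal[OF _ subspace_line_of assms(2)] r dim_line_of[of p]
    by (simp add: rank_dim_range)
qed

text \<open>Each point of the limit set is the image of a rank-one matrix of norm one, because the
  closure of the cone is closed under scaling. The unit sphere of matrices is compact, and a limit
  of such matrices is non-zero with image in the limit line.\<close>

lemma closed_limit_set: "closed (limit_set \<A>)"
  unfolding closed_sequential_limits
proof (intro allI impI, elim conjE)
  fix p q assume p: "\<forall>n. p n \<in> limit_set \<A>" and lim: "p \<longlonglongrightarrow> q"
  let ?C = "closure (semigroup_cone \<A>)"
  have "\<forall>n. \<exists>\<sigma>. \<sigma> \<in> ?C \<and> norm \<sigma> = 1 \<and> range (\<lambda>x. \<sigma> *v x) \<subseteq> line_of (p n)"
  proof
    fix n
    obtain \<pi> where \<pi>: "\<pi> \<in> ?C" "rank \<pi> = 1" "line_of (p n) = range (\<lambda>x. \<pi> *v x)"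
      using p unfolding limit_set_def by blast
    have "\<pi> \<noteq> 0" using \<pi>(2) by auto
    define \<sigma> where "\<sigma> = inverse (norm \<pi>) *\<^sub>R \<pi>"
    have "\<sigma> *v x \<in> line_of (p n)" for x
      using subspace_scale[OF subspace_line_of] \<pi>(3)
      by (metis \<sigma>_def rangeI scaleR_matrix_vector_assoc)
    then show "\<exists>\<sigma>. \<sigma> \<in> ?C \<and> norm \<sigma> = 1 \<and> range (\<lambda>x. \<sigma> *v x) \<subseteq> line_of (p n)"
      using \<open>\<pi> \<noteq> 0\<close> \<pi>(1) closure_semigroup_cone_scale by (intro exI[of _ \<sigma>]) (auto simp: \<sigma>_def)
  qed
  from choice[OF this] obtain \<sigma> where \<sigma>: "\<And>n. \<sigma> n \<in> ?C" "\<And>n. norm (\<sigma> n) = 1"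
    "\<And>n. range (\<lambda>x. \<sigma> n *v x) \<subseteq> line_of (p n)"
    by blast
  have "compact (?C \<inter> sphere 0 1)" by (intro closed_Int_compact closed_closure compact_sphere)
  moreover have "\<forall>n. \<sigma> n \<in> ?C \<inter> sphere 0 1" using \<sigma> by simp
  ultimately obtain \<tau> r where \<tau>: "\<tau> \<in> ?C \<inter> sphere 0 1" "strict_mono r" "(\<sigma> \<circ> r) \<longlonglongrightarrow> \<tau>"
    unfolding compact_def by blast
  have lim': "(\<lambda>n. \<sigma> (r n)) \<longlonglongrightarrow> \<tau>" using \<tau>(3) by (simp add: o_def)
  have "\<tau> *v x \<in> line_of q" for x
  proof (rule limit_in_limit_line)
    show "(\<sigma> \<circ> r) n *v x \<in> line_of ((p \<circ> r) n)" for n using \<sigma>(3) by auto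
    show "(\<lambda>n. (\<sigma> \<circ> r) n *v x) \<longlonglongrightarrow> \<tau> *v x"
      using lim' unfolding matrix_vector_mult_def
      by (intro vec_tendstoI) (auto intro!: tendsto_intros)
    show "(p \<circ> r) \<longlonglongrightarrow> q" using lim \<tau>(2) by (rule LIMSEQ_subseq_LIMSEQ)
  qed
  then have "range (\<lambda>x. \<tau> *v x) \<subseteq> line_of q" by blast
  moreover have "\<tau> \<noteq> 0" using \<tau>(1) by auto
  ultimately have "rank \<tau> = 1" "line_of q = range (\<lambda>x. \<tau> *v x)"
    using rank_one_range_eq_line by blast+
  then show "q \<in> limit_set \<A>" using \<tau>(1) unfolding limit_set_def by blast
qed

section \<open>Limit points are limits of attracting fixed points\<close>

text \<open>The projection \<open>v f\<close> has leading eigenvalue one, and this persists for all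
  matrices \<open>M\<close> close to it. The affine hyperplane \<open>f = 1\<close> is a chart of
  projective space around the line of \<open>v\<close>. The projection contracts the whole chart to
  \<open>v\<close>, hence \<open>M\<close>, followed by the central projection to the chart, maps a
  small ball of the chart into itself, and Brouwer's theorem gives an eigenvector of
  \<open>M\<close> close to \<open>v\<close>. The entries of the deflation of \<open>v f\<close>
  vanish, so those of the deflation of \<open>M\<close> are small.\<close>

lemma dominant_eigenpair_near_rank_one:
  fixes f v :: "real^'n"
  assumes fv: "f \<bullet> v = 1" and "0 < e"
  obtains d where "0 < d" and "\<And>M. dist M (rank_one_matrix v f) < d \<Longrightarrow>
    \<exists>x l. M *v x = l *\<^sub>R x \<and> f \<bullet> x = 1 \<and> dist x v < e \<and>
      (\<Sum>i\<in>UNIV. \<Sum>j\<in>UNIV. \<bar>M $ i $ j - x $ i * (f \<bullet> column j M)\<bar>) < \<bar>l\<bar>"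
proof -
  let ?Q = "rank_one_matrix v f"
  \<comment> \<open>Positivity of the gap is the hypothesis of the dominance criterion.\<close>
  define gap where "gap = (\<lambda>(M::real^'n^'n, x::real^'n). \<bar>f \<bullet> (M *v x)\<bar>
    - (\<Sum>i\<in>UNIV. \<Sum>j\<in>UNIV. \<bar>M $ i $ j - x $ i * (f \<bullet> column j M)\<bar>))"
  have "continuous_on UNIV gap"
    unfolding gap_def case_prod_beta inner_vec_def column_def matrix_vector_mult_def
    by (intro continuous_intros)
  then have "open {z. 0 < gap z}"
    using open_Collect_less[OF continuous_on_const] by blast
  moreover have "column j ?Q = f $ j *\<^sub>R v" for j
    by (simp add: vec_eq_iff column_def rank_one_matrix_def)
  then have "gap (?Q, v) = 1"
    by (simp add: gap_def fv) (simp add: rank_one_matrix_def)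
  ultimately obtain d1 where d1: "0 < d1" "\<And>z. dist z (?Q, v) < d1 \<Longrightarrow> 0 < gap z"
    unfolding open_dist by (metis mem_Collect_eq zero_less_one)
  define r where "r = min e (d1 / 2) / 2"
  have r: "0 < r" "r < e" "r < d1 / 2" using \<open>0 < e\<close> d1(1) by (auto simp: r_def)
  \<comment> \<open>The central projection to the chart.\<close>
  define g where "g y = (1 / (f \<bullet> y)) *\<^sub>R y" for y
  have "isCont g v" unfolding g_def using fv by (intro continuous_intros) auto
  moreover have "g v = v" by (simp add: g_def fv)
  ultimately have "\<forall>\<^sub>F y in nhds v. dist (g y) v < r"
    using r(1) by (metis isCont_def tendstoD tendsto_at_iff_tendsto_nhds)
  moreover have "\<forall>\<^sub>F y in nhds v. 0 < f \<bullet> y"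
    using order_tendstoD(1)[OF tendsto_inner[OF tendsto_const filterlim_ident], of 0 f v] fv by simp
  ultimately have "\<forall>\<^sub>F y in nhds v. dist (g y) v < r \<and> 0 < f \<bullet> y"
    by (rule eventually_conj)
  then obtain d2 where d2: "0 < d2" "\<And>y. dist y v < d2 \<Longrightarrow> dist (g y) v < r \<and> 0 < f \<bullet> y"
    by (auto simp: eventually_nhds_metric)
  \<comment> \<open>The first factors bound the norm of a matrix through its entries, the last one bounds the
    vectors of the ball.\<close>
  define c where "c = real CARD('n) * real CARD('n) * (norm v + r)"
  have "0 < c" using r by (auto simp: c_def intro!: mult_pos_pos add_nonneg_pos)
  show thesis
  proof
    show "0 < min (d1 / 2) (d2 / c)" using d1 d2 \<open>0 < c\<close> by simp
    fix M :: "real^'n^'n" assume "dist M ?Q < min (d1 / 2) (d2 / c)"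
    then have M: "dist M ?Q < d1 / 2" "dist M ?Q < d2 / c" by simp_all
    define K where "K = cball v r \<inter> {x. f \<bullet> x = 1}"
    have near: "dist (M *v x) v < d2" if "x \<in> K" for x
    proof -
      have "M *v x - v = (M - ?Q) *v x"
        using that by (simp add: K_def matrix_vector_mult_diff_rdistrib)
      then have "dist (M *v x) v \<le> (\<Sum>i\<in>UNIV. \<Sum>j\<in>UNIV. norm ((M - ?Q) $ i $ j)) * norm x"
        unfolding dist_norm using norm_matrix_vector_mult_le by metis
      also have "\<dots> \<le> (\<Sum>i\<in>(UNIV::'n set). \<Sum>j\<in>(UNIV::'n set). dist M ?Q) * (norm v + r)"
      proof (intro mult_mono sum_mono)
        show "norm ((M - ?Q) $ i $ j) \<le> dist M ?Q" for i j
          unfolding dist_norm by (meson Finite_Cartesian_Product.norm_nth_le order_trans)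
        have "norm x \<le> norm v + dist v x"
          using norm_triangle_ineq4[of v "v - x"] by (simp add: dist_norm)
        then show "norm x \<le> norm v + r" using that by (simp add: K_def)
      qed (auto intro!: sum_nonneg)
      also have "\<dots> = dist M ?Q * c" by (simp add: c_def)
      also have "\<dots> < d2" using M(2) \<open>0 < c\<close> by (simp add: pos_less_divide_eq)
      finally show ?thesis .
    qed
    have "compact K" unfolding K_def
      by (intro compact_Int_closed compact_cball closed_hyperplane)
    moreover have "convex K" unfolding K_def
      by (intro convex_Int convex_cball convex_hyperplane)
    moreover have "v \<in> K" using r fv by (simp add: K_def)
    then have "K \<noteq> {}" by blast
    moreover have "continuous_on K (\<lambda>x. g (M *v x))"
      unfolding g_def using near d2(2)
      by (intro continuous_intros matrix_vector_mult_linear_continuous_on) fastforce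
    moreover have "(\<lambda>x. g (M *v x)) \<in> K \<rightarrow> K"
    proof
      fix x assume "x \<in> K"
      then have "dist (g (M *v x)) v < r" "0 < f \<bullet> (M *v x)" using near d2(2) by blast+
      then show "g (M *v x) \<in> K" by (simp add: K_def g_def dist_commute less_imp_le)
    qed
    ultimately obtain x where x: "x \<in> K" "g (M *v x) = x" by (rule brouwer)
    have "0 < f \<bullet> (M *v x)" using near d2(2) x(1) by blast
    then have "M *v x = (f \<bullet> (M *v x)) *\<^sub>R g (M *v x)" by (simp add: g_def)
    moreover have "dist x v \<le> r" using x(1) by (simp add: K_def dist_commute)
    moreover have "dist (M, x) (?Q, v) < d1"
    proof -
      have "dist (M, x) (?Q, v) \<le> dist M ?Q + dist x v"
        by (simp add: dist_prod_def sqrt_sum_squares_le_sum)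
      then show ?thesis using M(1) \<open>dist x v \<le> r\<close> r(3) by simp
    qed
    then have "0 < gap (M, x)" by (rule d1(2))
    ultimately show "\<exists>x l. M *v x = l *\<^sub>R x \<and> f \<bullet> x = 1 \<and> dist x v < e \<and>
      (\<Sum>i\<in>UNIV. \<Sum>j\<in>UNIV. \<bar>M $ i $ j - x $ i * (f \<bullet> column j M)\<bar>) < \<bar>l\<bar>"
      using x r(2) by (intro exI[of _ x] exI[of _ "f \<bullet> (M *v x)"]) (auto simp: K_def gap_def)
  qed
qed

text \<open>The orbit of a non-zero vector spans a non-zero invariant subspace, hence everything,
  and is not contained in the kernel of a non-zero matrix.\<close>

lemma irreducible_not_in_kernel:
  assumes irr: "irreducible_matrices (generated_semigroup \<A>)"
    and B: "B \<in> generated_semigroup \<A>" "det B \<noteq> 0" and "x \<noteq> 0" and "\<pi> \<noteq> 0"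
  obtains C where "C \<in> generated_semigroup \<A>" "\<pi> *v (C *v x) \<noteq> 0"
proof -
  define L where "L = span ((\<lambda>C. C *v x) ` generated_semigroup \<A>)"
  have "(\<lambda>y. A *v y) ` L \<subseteq> L" if "A \<in> generated_semigroup \<A>" for A
  proof -
    have "(\<lambda>y. A *v y) ` (\<lambda>C. C *v x) ` generated_semigroup \<A> \<subseteq> (\<lambda>C. C *v x) ` generated_semigroup \<A>"
      using generated_semigroup.product[OF that] by (auto simp: matrix_vector_mul_assoc)
    then show ?thesis
      unfolding L_def using linear_span_image[OF matrix_vector_mul_linear[of A]] span_mono by metis
  qed
  moreover have "B *v x \<in> L" using B(1) by (auto simp: L_def intro: span_base)
  moreover have "B *v x \<noteq> 0" using B(2) \<open>x \<noteq> 0\<close> det_nonzero_iff_injective by blast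
  moreover have "subspace L" by (simp add: L_def)
  ultimately have "L = UNIV"
    using irr unfolding irreducible_matrices_def by blast
  have "\<exists>C\<in>generated_semigroup \<A>. \<pi> *v (C *v x) \<noteq> 0"
  proof (rule ccontr)
    assume "\<not> ?thesis"
    then have "L \<subseteq> {y. \<pi> *v y = 0}"
      unfolding L_def by (intro span_minimal linear_subspace_kernel matrix_vector_mul_linear) auto
    then have "\<forall>y. \<pi> *v y = 0" using \<open>L = UNIV\<close> by auto
    then show False using \<open>\<pi> \<noteq> 0\<close> by (simp add: matrix_eq)
  qed
  then show thesis using that by blast
qed

lemma rank_one_matrix_decomposition:
  fixes \<pi> :: "real^'n^'n"
  assumes "range (\<lambda>y. \<pi> *v y) = span {v}" "v \<noteq> 0" "\<pi> *v v \<noteq> 0"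
  obtains f m where "m \<noteq> 0" "f \<bullet> v = 1" "\<pi> = m *\<^sub>R rank_one_matrix v f"
proof -
  have in_span: "\<exists>c. \<pi> *v y = c *\<^sub>R v" for y
    using assms(1) by (metis rangeI rangeE span_singleton)
  define g where "g = (1 / (v \<bullet> v)) *\<^sub>R (transpose \<pi> *v v)"
  have g: "\<pi> *v y = (g \<bullet> y) *\<^sub>R v" for y
  proof -
    obtain c where c: "\<pi> *v y = c *\<^sub>R v" using in_span by blast
    have "g \<bullet> y = (v \<bullet> (\<pi> *v y)) / (v \<bullet> v)"
      by (simp add: g_def dot_lmul_matrix)
    then show ?thesis using c \<open>v \<noteq> 0\<close> by simp
  qed
  define m where "m = g \<bullet> v"
  have "m \<noteq> 0" using g[of v] assms(3) by (auto simp: m_def)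
  moreover have "((1 / m) *\<^sub>R g) \<bullet> v = 1" using \<open>m \<noteq> 0\<close> by (simp add: m_def)
  moreover have "\<pi> = m *\<^sub>R rank_one_matrix v ((1 / m) *\<^sub>R g)"
    using \<open>m \<noteq> 0\<close> by (simp add: matrix_eq g flip: scaleR_matrix_vector_assoc)
  ultimately show thesis using that by blast
qed

text \<open>The rank-one limit \<open>\<pi>\<close> with image \<open>p\<close> may be nilpotent,
  and then nearby matrices need not be proximal. Multiplying by a semigroup element \<open>D\<close>
  on the right keeps the image, and by irreducibility \<open>D\<close> can be chosen to move
  \<open>p\<close> out of the kernel of \<open>\<pi>\<close>. Then \<open>\<pi> D\<close> is a
  multiple of a projection to \<open>p\<close>, and the semigroup elements whose multiples approach
  it are proximal with attracting fixed points close to \<open>p\<close>.\<close>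

lemma attracting_fixed_point_near_limit_point:
  assumes irr: "irreducible_matrices (generated_semigroup \<A>)"
    and det: "\<And>A. A \<in> generated_semigroup \<A> \<Longrightarrow> det A \<noteq> 0"
    and p: "p \<in> limit_set \<A>" and "0 < e"
  shows "\<exists>A \<in> generated_semigroup \<A>. \<exists>q. proximal A \<and> is_attracting_fixed_point A q \<and> dist q p < e"
proof -
  let ?C = "closure (semigroup_cone \<A>)"
  obtain \<pi> where \<pi>: "\<pi> \<in> ?C" "rank \<pi> = 1" "line_of p = range (\<lambda>x. \<pi> *v x)"
    using p unfolding limit_set_def by blast
  have "\<pi> \<noteq> 0" using \<pi>(2) by auto
  have "semigroup_cone \<A> \<noteq> {}" using \<pi>(1) closure_empty by (metis empty_iff)
  then obtain B where B: "B \<in> generated_semigroup \<A>" by blast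
  define v where "v = unit_direction p"
  have v: "v \<in> line_of p" "v \<noteq> 0" using unit_direction[of p] by (auto simp: v_def)
  obtain D where D: "D \<in> generated_semigroup \<A>" "\<pi> *v (D *v v) \<noteq> 0"
    using irreducible_not_in_kernel[OF irr B det[OF B] v(2) \<open>\<pi> \<noteq> 0\<close>] by blast
  have nz: "(\<pi> ** D) *v v \<noteq> 0" using D(2) by (simp add: matrix_vector_mul_assoc)
  have "range (\<lambda>y. (\<pi> ** D) *v y) \<subseteq> line_of p"
    by (auto simp: \<pi>(3) simp flip: matrix_vector_mul_assoc)
  moreover have "\<pi> ** D \<noteq> 0" using nz by auto
  ultimately have "line_of p = range (\<lambda>y. (\<pi> ** D) *v y)"
    using rank_one_range_eq_line by blast
  then have "range (\<lambda>y. (\<pi> ** D) *v y) = span {v}" using line_of_span[OF v] by simp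
  then obtain f m where fm: "m \<noteq> 0" "f \<bullet> v = 1" "\<pi> ** D = m *\<^sub>R rank_one_matrix v f"
    using rank_one_matrix_decomposition[OF _ v(2) nz] by blast
  have "rank_one_matrix v f = (1 / m) *\<^sub>R (\<pi> ** D)" using fm by simp
  then have cone: "rank_one_matrix v f \<in> ?C"
    using closure_semigroup_cone_scale[OF closure_semigroup_cone_mult_right[OF \<pi>(1) D(1)]] by simp
  obtain d where d: "0 < d" "\<And>x q. dist x v < d \<Longrightarrow> x \<in> line_of q \<Longrightarrow> x \<noteq> 0 \<Longrightarrow> dist q p < e"
    using dist_lines_small[OF v \<open>0 < e\<close>] by blast
  obtain d' where d': "0 < d'" "\<And>M. dist M (rank_one_matrix v f) < d' \<Longrightarrow>
    \<exists>x l. M *v x = l *\<^sub>R x \<and> f \<bullet> x = 1 \<and> dist x v < d \<and>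
      (\<Sum>i\<in>UNIV. \<Sum>j\<in>UNIV. \<bar>M $ i $ j - x $ i * (f \<bullet> column j M)\<bar>) < \<bar>l\<bar>"
    using dominant_eigenpair_near_rank_one[OF fm(2) d(1)] by blast
  obtain k A where A: "A \<in> generated_semigroup \<A>" "dist (k *\<^sub>R A) (rank_one_matrix v f) < d'"
    using cone d'(1) unfolding closure_approachable by blast
  obtain x l where x: "(k *\<^sub>R A) *v x = l *\<^sub>R x" "f \<bullet> x = 1" "dist x v < d"
    and l: "(\<Sum>i\<in>UNIV. \<Sum>j\<in>UNIV. \<bar>(k *\<^sub>R A) $ i $ j - x $ i * (f \<bullet> column j (k *\<^sub>R A))\<bar>) < \<bar>l\<bar>"
    using d'(2)[OF A(2)] by blast
  have "x \<noteq> 0" using x(2) by auto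
  \<comment> \<open>Since \<open>l\<close> is non-zero, so is \<open>k\<close>, and the criterion can be transferred from \<open>k A\<close> to \<open>A\<close>.\<close>
  have "0 < \<bar>l\<bar>" using l by (rule le_less_trans[rotated]) (auto intro!: sum_nonneg)
  then have "k \<noteq> 0" using x(1) \<open>x \<noteq> 0\<close> by auto
  have Ax: "A *v x = (l / k) *\<^sub>R x"
    using x(1) \<open>k \<noteq> 0\<close> by (metis divide_inverse mult.commute scaleR_matrix_vector_assoc scaleR_scaleR
      right_inverse left_inverse scaleR_one)
  have "(k *\<^sub>R A) $ i $ j - x $ i * (f \<bullet> column j (k *\<^sub>R A)) = k * (A $ i $ j - x $ i * (f \<bullet> column j A))" for i j
  proof -
    have "column j (k *\<^sub>R A) = k *\<^sub>R column j A" by (simp add: vec_eq_iff column_def)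
    then show ?thesis by (simp add: algebra_simps)
  qed
  then have "\<bar>k\<bar> * (\<Sum>i\<in>UNIV. \<Sum>j\<in>UNIV. \<bar>A $ i $ j - x $ i * (f \<bullet> column j A)\<bar>) < \<bar>l\<bar>"
    using l by (simp add: abs_mult sum_distrib_left)
  then have small: "(\<Sum>i\<in>UNIV. \<Sum>j\<in>UNIV. \<bar>A $ i $ j - x $ i * (f \<bullet> column j A)\<bar>) < \<bar>l / k\<bar>"
    using \<open>k \<noteq> 0\<close> by (simp add: field_simps)
  define q where "q = Abs_projective_space (span {x})"
  have q: "line_of q = span {x}"
    using \<open>x \<noteq> 0\<close> unfolding q_def by (intro Abs_projective_space_inverse) simp
  have "is_attracting_fixed_point A q" "proximal A"
    using dominant_eigenpair_criterion[OF Ax x(2) small] q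
    unfolding is_attracting_fixed_point_def proximal_def by blast+
  moreover have "dist q p < e" using d(2)[OF x(3) _ \<open>x \<noteq> 0\<close>] q by (simp add: span_base)
  ultimately show ?thesis using A(1) by blast
qed

theorem theorem1p2:
  fixes \<A> :: "(real^'n^'n) set"
  assumes "\<And>A. A \<in> \<A> \<Longrightarrow> det A = 1"
    and "irreducible_matrices (generated_semigroup \<A>)"
    and "\<exists>A \<in> generated_semigroup \<A>. proximal A"
  shows "limit_set \<A> =
    closure {p. \<exists>A \<in> generated_semigroup \<A>. proximal A \<and> is_attracting_fixed_point A p}"
proof (rule antisym)
  have det: "det A \<noteq> 0" if "A \<in> generated_semigroup \<A>" for A
    using generated_semigroup_det_1[OF assms(1) that] by simp
  show "limit_set \<A> \<subseteq>
    closure {p. \<exists>A \<in> generated_semigroup \<A>. proximal A \<and> is_attracting_fixed_point A p}"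
    using attracting_fixed_point_near_limit_point[OF assms(2) det]
    by (auto simp: closure_approachable) blast
  show "closure {p. \<exists>A \<in> generated_semigroup \<A>. proximal A \<and> is_attracting_fixed_point A p}
      \<subseteq> limit_set \<A>"
    using attracting_fixed_point_in_limit_set det
    by (intro closure_minimal closed_limit_set) blast
qed

end
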